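(* Let $\alpha:I\to\mathbb{I}^3$ be an admissible regular curve (of class $C^3$) in the simply isotropic space, parametrized by isotropic arc-length. Then $\alpha$ lies on the surface of an isotropic sphere if and only if its normal development, i.e. the curve $(\kappa_1(s),\kappa_2(s))$, lies on a line not passing through the origin. In addition, $\alpha$ is a spherical curve of cylindrical type with radius $r$ (i.e. lies on a sphere of cylindrical type of radius $r$) if and only if $\kappa$ is constant and equal to $r^{-1}$.
   Context: The simply isotropic space $\mathbb{I}^3$ is $\mathbb{R}^3$ with the degenerate inner product $\langle\mathbf u,\mathbf v\rangle_z=u_1v_1+u_2v_2$, $\Vert\mathbf u\Vert_z=\sqrt{\langle\mathbf u,\mathbf u\rangle_z}$. Arc-length means $\Vert\alpha'\Vert_z=1$. $\alpha=(x,y,z)$ is admissible if $x'y''-x''y'\neq0$ everywhere. Isotropic spheres are the surfaces of the family $(x^2+y^2)+2c_1x+2c_2y+2c_3z+c_4=0$ with real constants $c_i$ (non-degenerate: parabolic type if $c_3\ne0$; cylindrical type if $c_3=0$, i.e. $\{\mathbf x:\langle\mathbf x-P,\mathbf x-P\rangle_z=r^2\}$ with radius $r>0$). Isotropic Frenet frame: $\mathbf t=\alpha'$, $\kappa=\Vert\mathbf t'\Vert_z>0$, $\mathbf n=\mathbf t'/\kappa$, $\mathbf b=(0,0,1)$; it satisfies $\mathbf t'=\kappa\mathbf n$, $\mathbf n'=-\kappa\mathbf t+\tau\mathbf b$, $\mathbf b'=0$, which defines the isotropic torsion $\tau$. A rotation minimizing frame is $\{\mathbf t,\mathbf n_1,\mathbf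 n_2\}$ with $\mathbf n_1=\mathbf n-\theta\mathbf b$, $\mathbf n_2=\mathbf b$, where $\theta'=\tau$ ($\theta$ is determined up to an additive constant); then $\mathbf t'=\kappa_1\mathbf n_1+\kappa_2\mathbf n_2$, $\mathbf n_1'=-\kappa_1\mathbf t$, with $\kappa_1=\kappa$, $\kappa_2=\kappa\theta$. The normal development is $(\kappa_1,\kappa_2)$. *)

theory Defs
  imports "HOL-Analysis.Analysis"
begin

text \<open>Curves are defined on an arbitrary interval \<open>I\<close>, which need not be open, so all
  derivatives are taken within \<open>I\<close>.\<close>

definition deriv_on :: "real set \<Rightarrow> (real \<Rightarrow> 'a::real_normed_vector) \<Rightarrow> real \<Rightarrow> 'a" where
  "deriv_on I f = (\<lambda>s. vector_derivative f (at s within I))"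

definition C_k_on :: "nat \<Rightarrow> real set \<Rightarrow> (real \<Rightarrow> 'a::real_normed_vector) \<Rightarrow> bool" where
  "C_k_on k I f \<longleftrightarrow>
     (\<forall>j<k. (deriv_on I ^^ j) f differentiable_on I) \<and> continuous_on I ((deriv_on I ^^ k) f)"

definition iso_inner :: "real^3 \<Rightarrow> real^3 \<Rightarrow> real" where
  "iso_inner u v = u $ 1 * v $ 1 + u $ 2 * v $ 2"

definition iso_norm :: "real^3 \<Rightarrow> real" where
  "iso_norm u = sqrt (iso_inner u u)"

definition regular_curve :: "real set \<Rightarrow> (real \<Rightarrow> real^3) \<Rightarrow> bool" where
  "regular_curve I \<alpha> \<longleftrightarrow> (\<forall>s\<in>I. deriv_on I \<alpha> s \<noteq> 0)"

definition admissible :: "real set \<Rightarrow> (real \<Rightarrow> real^3) \<Rightarrow> bool" where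
  "admissible I \<alpha> \<longleftrightarrow>
     (\<forall>s\<in>I. deriv_on I \<alpha> s $ 1 * deriv_on I (deriv_on I \<alpha>) s $ 2
            - deriv_on I (deriv_on I \<alpha>) s $ 1 * deriv_on I \<alpha> s $ 2 \<noteq> 0)"

definition iso_arclength :: "real set \<Rightarrow> (real \<Rightarrow> real^3) \<Rightarrow> bool" where
  "iso_arclength I \<alpha> \<longleftrightarrow> (\<forall>s\<in>I. iso_norm (deriv_on I \<alpha> s) = 1)"

definition frenet_t :: "real set \<Rightarrow> (real \<Rightarrow> real^3) \<Rightarrow> real \<Rightarrow> real^3" where
  "frenet_t I \<alpha> = deriv_on I \<alpha>"

definition iso_curvature :: "real set \<Rightarrow> (real \<Rightarrow> real^3) \<Rightarrow> real \<Rightarrow> real" where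
  "iso_curvature I \<alpha> s = iso_norm (deriv_on I (frenet_t I \<alpha>) s)"

definition frenet_n :: "real set \<Rightarrow> (real \<Rightarrow> real^3) \<Rightarrow> real \<Rightarrow> real^3" where
  "frenet_n I \<alpha> s = deriv_on I (frenet_t I \<alpha>) s /\<^sub>R iso_curvature I \<alpha> s"

definition frenet_b :: "real^3" where
  "frenet_b = vector [0, 0, 1]"

text \<open>The torsion is defined through the Frenet equation for \<open>n'\<close>; existence and uniqueness of
  \<open>\<tau>\<close> for admissible unit speed curves is \<open>isotropic_curve.frenet_n_deriv_iff\<close> below.\<close>

definition iso_torsion :: "real set \<Rightarrow> (real \<Rightarrow> real^3) \<Rightarrow> real \<Rightarrow> real" where
  "iso_torsion I \<alpha> s =
     (THE \<tau>. deriv_on I (frenet_n I \<alpha>) s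
        = - iso_curvature I \<alpha> s *\<^sub>R frenet_t I \<alpha> s + \<tau> *\<^sub>R frenet_b)"

text \<open>A rotation minimizing frame is determined by a primitive \<open>\<theta>\<close> of the torsion, which exists by
  \<open>isotropic_curve.rm_angle_exists\<close> and is unique up to an additive constant.  The equations
  \<open>t' = \<kappa>\<^sub>1 n\<^sub>1 + \<kappa>\<^sub>2 n\<^sub>2\<close> and \<open>n\<^sub>1' = - \<kappa>\<^sub>1 t\<close> are \<open>rm_t_deriv\<close> and
  \<open>rm_n1_deriv\<close> in the same locale.\<close>

definition rm_angle :: "real set \<Rightarrow> (real \<Rightarrow> real^3) \<Rightarrow> (real \<Rightarrow> real) \<Rightarrow> bool" where
  "rm_angle I \<alpha> \<theta> \<longleftrightarrow>
     (\<forall>s\<in>I. (\<theta> has_real_derivative iso_torsion I \<alpha> s) (at s within I))"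

definition rm_n1 :: "real set \<Rightarrow> (real \<Rightarrow> real^3) \<Rightarrow> (real \<Rightarrow> real) \<Rightarrow> real \<Rightarrow> real^3" where
  "rm_n1 I \<alpha> \<theta> s = frenet_n I \<alpha> s - \<theta> s *\<^sub>R frenet_b"

definition rm_n2 :: "real^3" where
  "rm_n2 = frenet_b"

definition rm_kappa1 :: "real set \<Rightarrow> (real \<Rightarrow> real^3) \<Rightarrow> real \<Rightarrow> real" where
  "rm_kappa1 I \<alpha> s = iso_curvature I \<alpha> s"

definition rm_kappa2 :: "real set \<Rightarrow> (real \<Rightarrow> real^3) \<Rightarrow> (real \<Rightarrow> real) \<Rightarrow> real \<Rightarrow> real" where
  "rm_kappa2 I \<alpha> \<theta> s = iso_curvature I \<alpha> s * \<theta> s"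

definition normal_development ::
    "real set \<Rightarrow> (real \<Rightarrow> real^3) \<Rightarrow> (real \<Rightarrow> real) \<Rightarrow> real \<Rightarrow> real \<times> real" where
  "normal_development I \<alpha> \<theta> s = (rm_kappa1 I \<alpha> s, rm_kappa2 I \<alpha> \<theta> s)"

definition iso_quadric :: "real \<Rightarrow> real \<Rightarrow> real \<Rightarrow> real \<Rightarrow> (real^3) set" where
  "iso_quadric c1 c2 c3 c4 =
     {x. ((x $ 1)\<^sup>2 + (x $ 2)\<^sup>2) + 2 * c1 * x $ 1 + 2 * c2 * x $ 2 + 2 * c3 * x $ 3 + c4 = 0}"

definition cylindrical_sphere :: "real^3 \<Rightarrow> real \<Rightarrow> (real^3) set" where
  "cylindrical_sphere P r = {x. iso_inner (x - P) (x - P) = r\<^sup>2}"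

text \<open>For \<open>c3 = 0\<close> the quadric is a cylinder of squared radius \<open>c1\<^sup>2 + c2\<^sup>2 - c4\<close> if this number is
  positive, and degenerates to a line or the empty set otherwise.\<close>

definition isotropic_sphere :: "(real^3) set \<Rightarrow> bool" where
  "isotropic_sphere S \<longleftrightarrow>
     (\<exists>c1 c2 c3 c4. S = iso_quadric c1 c2 c3 c4 \<and> (c3 \<noteq> 0 \<or> c1\<^sup>2 + c2\<^sup>2 - c4 > 0))"

lemma cylindrical_sphere_eq_iso_quadric:
  "cylindrical_sphere P r = iso_quadric (- P $ 1) (- P $ 2) 0 ((P $ 1)\<^sup>2 + (P $ 2)\<^sup>2 - r\<^sup>2)"
  by (auto simp: cylindrical_sphere_def iso_quadric_def iso_inner_def power2_eq_square algebra_simps)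

lemma isotropic_sphere_cylindrical:
  assumes "r > 0" shows "isotropic_sphere (cylindrical_sphere P r)"
  unfolding isotropic_sphere_def cylindrical_sphere_eq_iso_quadric
  using assms by (intro exI conjI refl) auto

lemma iso_quadric_eq_cylindrical_sphere:
  assumes "c1\<^sup>2 + c2\<^sup>2 - c4 > 0"
  shows "iso_quadric c1 c2 0 c4
    = cylindrical_sphere (vector [- c1, - c2, 0]) (sqrt (c1\<^sup>2 + c2\<^sup>2 - c4))"
  using assms by (simp add: cylindrical_sphere_eq_iso_quadric)

text \<open>A line of the plane is an affine subspace of dimension 1.\<close>

definition plane_line :: "(real \<times> real) set \<Rightarrow> bool" where
  "plane_line L \<longleftrightarrow> affine L \<and> aff_dim L = 1"

lemma deriv_on_eqI:
  assumes I: "is_interval I" "interior I \<noteq> {}" and "s \<in> I"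
    and f: "(f has_vector_derivative y) (at s within I)"
  shows "deriv_on I f s = y"
proof -
  have "I \<noteq> {s}"
    using I(2) by auto
  then have "s islimpt I"
    using I(1) \<open>s \<in> I\<close> connected_imp_perfect is_interval_connected by blast
  then have "at s within I \<noteq> bot"
    using trivial_limit_within by blast
  then show ?thesis
    unfolding deriv_on_def using f by (rule vector_derivative_within)
qed

lemma differentiable_on_deriv_on:
  assumes "f differentiable_on I" "s \<in> I"
  shows "(f has_vector_derivative deriv_on I f s) (at s within I)"
  using assms unfolding deriv_on_def differentiable_on_def
  by (simp add: vector_derivative_works)

lemma vec_nth_has_real_derivative:
  fixes f :: "real \<Rightarrow> real^'n"
  assumes "(f has_vector_derivative y) (at s within I)"
  shows "((\<lambda>s. f s $ i) has_real_derivative y $ i) (at s within I)"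
  using bounded_linear.has_vector_derivative[OF bounded_linear_vec_nth assms]
  by (simp add: has_real_derivative_iff_has_vector_derivative)

lemma const_on_deriv:
  fixes f :: "real \<Rightarrow> real"
  assumes I: "is_interval I" "interior I \<noteq> {}" and "s \<in> I"
    and "\<And>x. x \<in> I \<Longrightarrow> f x = c" and f: "(f has_real_derivative y) (at s within I)"
  shows "y = 0"
proof -
  have "((\<lambda>x. c) has_vector_derivative y) (at s within I)"
    using f assms(3,4) has_vector_derivative_transform[of s I "\<lambda>_. c" f y]
    by (simp add: has_real_derivative_iff_has_vector_derivative)
  then show ?thesis
    using deriv_on_eqI[OF I \<open>s \<in> I\<close>, of "\<lambda>x. c" y] deriv_on_eqI[OF I \<open>s \<in> I\<close>, of "\<lambda>x. c" 0]
    by simp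
qed

lemma frenet_b_nth [simp]: "frenet_b $ 1 = 0" "frenet_b $ 2 = 0" "frenet_b $ 3 = 1"
  by (simp_all add: frenet_b_def)

lemma plane_frame_identity:
  fixes t1 t2 a1 a2 b1 b2 :: real
  assumes "t1\<^sup>2 + t2\<^sup>2 = 1" "t1 * a1 + t2 * a2 = 0" "a1\<^sup>2 + a2\<^sup>2 + t1 * b1 + t2 * b2 = 0"
  shows "(a1\<^sup>2 + a2\<^sup>2) * b1 - (a1 * b1 + a2 * b2) * a1 = - ((a1\<^sup>2 + a2\<^sup>2)\<^sup>2) * t1"
    and "(a1\<^sup>2 + a2\<^sup>2) * b2 - (a1 * b1 + a2 * b2) * a2 = - ((a1\<^sup>2 + a2\<^sup>2)\<^sup>2) * t2"
proof -
  define D where "D = t1 * a2 - t2 * a1"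
  have "a2 - t1 * D = a2 * (1 - (t1\<^sup>2 + t2\<^sup>2)) + t2 * (t1 * a1 + t2 * a2)"
    "a1 + t2 * D = a1 * (1 - (t1\<^sup>2 + t2\<^sup>2)) + t1 * (t1 * a1 + t2 * a2)"
    by (simp_all add: D_def power2_eq_square algebra_simps)
  then have a: "a2 = t1 * D" "a1 = - (t2 * D)"
    using assms by simp_all
  have "a1\<^sup>2 + a2\<^sup>2 = (t1\<^sup>2 + t2\<^sup>2) * D\<^sup>2"
    by (simp add: a power2_eq_square algebra_simps)
  then have k: "a1\<^sup>2 + a2\<^sup>2 = D\<^sup>2"
    using assms by simp
  then have b: "t1 * b1 + t2 * b2 = - D\<^sup>2"
    using assms(3) by simp
  have "(a1\<^sup>2 + a2\<^sup>2) * b1 - (a1 * b1 + a2 * b2) * a1 = D\<^sup>2 * t1 * (t1 * b1 + t2 * b2)"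
    "(a1\<^sup>2 + a2\<^sup>2) * b2 - (a1 * b1 + a2 * b2) * a2 = D\<^sup>2 * t2 * (t1 * b1 + t2 * b2)"
    by (simp_all add: a power2_eq_square algebra_simps)
  then show "(a1\<^sup>2 + a2\<^sup>2) * b1 - (a1 * b1 + a2 * b2) * a1 = - ((a1\<^sup>2 + a2\<^sup>2)\<^sup>2) * t1"
    "(a1\<^sup>2 + a2\<^sup>2) * b2 - (a1 * b1 + a2 * b2) * a2 = - ((a1\<^sup>2 + a2\<^sup>2)\<^sup>2) * t2"
    unfolding b k by (simp_all add: power2_eq_square algebra_simps)
qed

locale isotropic_curve =
  fixes I :: "real set" and \<alpha> :: "real \<Rightarrow> real^3"
  assumes I: "is_interval I" "interior I \<noteq> {}"
    and C3: "C_k_on 3 I \<alpha>" and adm: "admissible I \<alpha>" and arc: "iso_arclength I \<alpha>"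
begin

abbreviation "T \<equiv> deriv_on I \<alpha>"
abbreviation "A \<equiv> deriv_on I T"
abbreviation "B \<equiv> deriv_on I A"

lemma derivs:
  assumes "s \<in> I"
  shows "(\<alpha> has_vector_derivative T s) (at s within I)"
    and "(T has_vector_derivative A s) (at s within I)"
    and "(A has_vector_derivative B s) (at s within I)"
proof -
  have *: "(deriv_on I ^^ j) \<alpha> differentiable_on I" if "j < 3" for j
    using C3 that by (simp add: C_k_on_def)
  show "(\<alpha> has_vector_derivative T s) (at s within I)"
    using differentiable_on_deriv_on[OF *[of 0] assms] by simp
  show "(T has_vector_derivative A s) (at s within I)"
    using differentiable_on_deriv_on[OF *[of 1] assms] by simp
  show "(A has_vector_derivative B s) (at s within I)"
    using differentiable_on_deriv_on[OF *[of 2] assms] by (simp add: numeral_2_eq_2)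
qed

lemma continuous_B: "continuous_on I B"
  using C3 by (simp add: C_k_on_def numeral_3_eq_3)

lemma unit: "s \<in> I \<Longrightarrow> (T s $ 1)\<^sup>2 + (T s $ 2)\<^sup>2 = 1"
  using arc by (simp add: iso_arclength_def iso_norm_def iso_inner_def power2_eq_square)

lemma orth: assumes "s \<in> I" shows "T s $ 1 * A s $ 1 + T s $ 2 * A s $ 2 = 0"
proof -
  have "((\<lambda>s. (T s $ 1)\<^sup>2 + (T s $ 2)\<^sup>2) has_real_derivative
      2 * (T s $ 1 * A s $ 1 + T s $ 2 * A s $ 2)) (at s within I)"
    by (rule derivative_eq_intros vec_nth_has_real_derivative derivs assms refl | simp)+
  from const_on_deriv[OF I assms unit this] show ?thesis by simp
qed

lemma orth': assumes "s \<in> I"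
  shows "(A s $ 1)\<^sup>2 + (A s $ 2)\<^sup>2 + T s $ 1 * B s $ 1 + T s $ 2 * B s $ 2 = 0"
proof -
  have "((\<lambda>s. T s $ 1 * A s $ 1 + T s $ 2 * A s $ 2) has_real_derivative
      (A s $ 1)\<^sup>2 + (A s $ 2)\<^sup>2 + T s $ 1 * B s $ 1 + T s $ 2 * B s $ 2) (at s within I)"
    by (rule derivative_eq_intros vec_nth_has_real_derivative derivs assms refl
        | simp add: power2_eq_square algebra_simps)+
  from const_on_deriv[OF I assms orth this] show ?thesis by simp
qed

lemma curvature_eq: "iso_curvature I \<alpha> s = sqrt ((A s $ 1)\<^sup>2 + (A s $ 2)\<^sup>2)"
  by (simp add: iso_curvature_def frenet_t_def iso_norm_def iso_inner_def power2_eq_square)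

lemma curvature_pos: assumes "s \<in> I" shows "iso_curvature I \<alpha> s > 0"
proof -
  have "A s $ 1 \<noteq> 0 \<or> A s $ 2 \<noteq> 0"
    using adm assms by (auto simp: admissible_def)
  then show ?thesis
    by (auto simp: curvature_eq sum_power2_gt_zero_iff)
qed

definition "dk s = (A s $ 1 * B s $ 1 + A s $ 2 * B s $ 2) / iso_curvature I \<alpha> s"

lemma curvature_deriv: assumes "s \<in> I"
  shows "(iso_curvature I \<alpha> has_real_derivative dk s) (at s within I)"
proof -
  have pos: "(A s $ 1)\<^sup>2 + (A s $ 2)\<^sup>2 > 0"
    using curvature_pos[OF assms] by (simp add: curvature_eq)
  have "((\<lambda>s. (A s $ 1)\<^sup>2 + (A s $ 2)\<^sup>2) has_real_derivative
      2 * (A s $ 1 * B s $ 1 + A s $ 2 * B s $ 2)) (at s within I)"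
    by (rule derivative_eq_intros vec_nth_has_real_derivative derivs assms refl | simp)+
  note * = DERIV_chain2[OF DERIV_real_sqrt[OF pos] this]
  have "inverse k / 2 * (2 * x) = x / k" for k x :: real
    by (simp add: field_simps)
  with * show ?thesis
    by (simp only: curvature_eq[abs_def] dk_def)
qed

definition "dn s = B s /\<^sub>R iso_curvature I \<alpha> s - (dk s / (iso_curvature I \<alpha> s)\<^sup>2) *\<^sub>R A s"

lemma frenet_n_has_deriv: assumes "s \<in> I"
  shows "(frenet_n I \<alpha> has_vector_derivative dn s) (at s within I)"
proof -
  have "((\<lambda>s. inverse (iso_curvature I \<alpha> s)) has_real_derivative
      - (dk s / (iso_curvature I \<alpha> s)\<^sup>2)) (at s within I)"
    using DERIV_inverse_fun[OF curvature_deriv[OF assms]] curvature_pos[OF assms]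
    by (simp add: divide_simps power2_eq_square)
  from has_vector_derivative_scaleR[OF this derivs(3)[OF assms]] show ?thesis
    unfolding frenet_n_def[abs_def] frenet_t_def dn_def by (simp add: algebra_simps)
qed

lemma dn_eq: assumes "s \<in> I"
  shows "dn s = - iso_curvature I \<alpha> s *\<^sub>R frenet_t I \<alpha> s
    + (dn s $ 3 + iso_curvature I \<alpha> s * T s $ 3) *\<^sub>R frenet_b"
proof -
  define k where "k = iso_curvature I \<alpha> s"
  have k: "k > 0" "(A s $ 1)\<^sup>2 + (A s $ 2)\<^sup>2 = k\<^sup>2"
    using curvature_pos[OF assms] by (simp_all add: k_def curvature_eq)
  note e = plane_frame_identity[OF unit[OF assms] orth[OF assms] orth'[OF assms], unfolded k(2)]
  have dn: "dn s $ i
      = (k\<^sup>2 * B s $ i - (A s $ 1 * B s $ 1 + A s $ 2 * B s $ 2) * A s $ i) / (k\<^sup>2 * k)" for i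
    using k(1) by (simp add: dn_def dk_def k_def[symmetric] divide_simps power2_eq_square)
  have "dn s $ 1 = - k * T s $ 1" "dn s $ 2 = - k * T s $ 2"
    unfolding dn e using k(1) by (simp_all add: divide_simps power2_eq_square)
  then show ?thesis
    by (simp add: vec_eq_iff forall_3 frenet_t_def k_def)
qed

lemma frenet_n_deriv_iff: assumes "s \<in> I"
  shows "deriv_on I (frenet_n I \<alpha>) s
      = - iso_curvature I \<alpha> s *\<^sub>R frenet_t I \<alpha> s + \<tau> *\<^sub>R frenet_b
    \<longleftrightarrow> \<tau> = dn s $ 3 + iso_curvature I \<alpha> s * T s $ 3"
  using dn_eq[OF assms] deriv_on_eqI[OF I assms frenet_n_has_deriv[OF assms]]
  by (metis add_left_cancel frenet_b_nth(3) mult.right_neutral vector_scaleR_component real_scaleR_def)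

lemma iso_torsion_eq: assumes "s \<in> I"
  shows "iso_torsion I \<alpha> s = dn s $ 3 + iso_curvature I \<alpha> s * T s $ 3"
  unfolding iso_torsion_def frenet_n_deriv_iff[OF assms] by simp

lemma frenet_n_deriv: assumes "s \<in> I"
  shows "(frenet_n I \<alpha> has_vector_derivative
    - iso_curvature I \<alpha> s *\<^sub>R frenet_t I \<alpha> s + iso_torsion I \<alpha> s *\<^sub>R frenet_b) (at s within I)"
  using frenet_n_has_deriv[OF assms] dn_eq[OF assms] iso_torsion_eq[OF assms] by simp

lemma rm_t_deriv: assumes "s \<in> I"
  shows "(frenet_t I \<alpha> has_vector_derivative
    rm_kappa1 I \<alpha> s *\<^sub>R rm_n1 I \<alpha> \<theta> s + rm_kappa2 I \<alpha> \<theta> s *\<^sub>R rm_n2) (at s within I)"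
  using derivs(2)[OF assms] curvature_pos[OF assms]
  by (simp add: rm_kappa1_def rm_kappa2_def rm_n1_def rm_n2_def frenet_n_def frenet_t_def
      scaleR_right_diff_distrib)

lemma rm_n1_deriv: assumes "s \<in> I" "rm_angle I \<alpha> \<theta>"
  shows "(rm_n1 I \<alpha> \<theta> has_vector_derivative
    - rm_kappa1 I \<alpha> s *\<^sub>R frenet_t I \<alpha> s) (at s within I)"
proof -
  have "(\<theta> has_real_derivative iso_torsion I \<alpha> s) (at s within I)"
    using assms by (simp add: rm_angle_def)
  from has_vector_derivative_diff[OF frenet_n_deriv[OF assms(1)]
      has_vector_derivative_scaleR[OF this has_vector_derivative_const[of frenet_b]]]
  show ?thesis
    unfolding rm_n1_def[abs_def] rm_kappa1_def by simp
qed

lemma continuous_torsion: "continuous_on I (iso_torsion I \<alpha>)"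
proof -
  have c: "continuous_on I T" "continuous_on I A" "continuous_on I (iso_curvature I \<alpha>)"
    using derivs curvature_deriv has_vector_derivative_continuous DERIV_continuous
    unfolding continuous_on_eq_continuous_within by blast+
  have nz: "\<forall>s\<in>I. iso_curvature I \<alpha> s \<noteq> 0"
    using curvature_pos by force
  have "continuous_on I (\<lambda>s. dn s $ 3 + iso_curvature I \<alpha> s * T s $ 3)"
    unfolding dn_def dk_def using nz
    by (auto intro!: continuous_intros c continuous_B)
  then show ?thesis
    by (rule continuous_on_eq) (simp add: iso_torsion_eq)
qed

lemma rm_angle_exists: "\<exists>\<theta>. rm_angle I \<alpha> \<theta>"
proof -
  let ?f = "iso_torsion I \<alpha>"
  obtain c where c: "c \<in> I"
    using I(2) interior_subset by blast
  define \<theta> where "\<theta> s = (if c \<le> s then integral {c..s} ?f else - integral {s..c} ?f)" for s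
  have sub: "{a..b} \<subseteq> I" if "a \<in> I" "b \<in> I" for a b
    using I(1) that unfolding is_interval_1 by (meson atLeastAtMost_iff subsetI)
  have on_ab: "(\<theta> has_vector_derivative ?f s) (at s within {a..b})"
    if ab: "a \<in> I" "b \<in> I" "a \<le> c" "c \<le> b" and s: "s \<in> {a..b}" for a b s
  proof -
    have cont: "continuous_on {a..b} ?f"
      using continuous_torsion sub[OF ab(1,2)] continuous_on_subset by blast
    have int: "?f integrable_on {u..v}" if "a \<le> u" "v \<le> b" for u v
      using cont that by (intro integrable_continuous_real) (auto intro: continuous_on_subset)
    have eq: "\<theta> u = integral {a..u} ?f - integral {a..c} ?f" if "u \<in> {a..b}" for u
    proof (cases "c \<le> u")
      case True
      have "integral {a..c} ?f + integral {c..u} ?f = integral {a..u} ?f"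
        using True that ab by (intro Henstock_Kurzweil_Integration.integral_combine int) auto
      with True show ?thesis by (simp add: \<theta>_def)
    next
      case False
      have "integral {a..u} ?f + integral {u..c} ?f = integral {a..c} ?f"
        using False that ab by (intro Henstock_Kurzweil_Integration.integral_combine int) auto
      with False show ?thesis by (simp add: \<theta>_def)
    qed
    have "((\<lambda>u. integral {a..u} ?f - integral {a..c} ?f) has_vector_derivative ?f s - 0)
        (at s within {a..b})"
      by (intro has_vector_derivative_diff integral_has_vector_derivative cont s
          has_vector_derivative_const)
    then show ?thesis
      using has_vector_derivative_transform[OF s eq] by simp
  qed
  have "(\<theta> has_vector_derivative ?f s) (at s within I)" if s: "s \<in> I" for s
  proof -
    have m: "min c s \<in> I" "max c s \<in> I"
      using c s by (simp_all add: min_def max_def)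
    obtain a where a: "a \<in> I" "a \<le> min c s" "a < min c s \<or> (\<forall>x\<in>I. min c s \<le> x)"
      using m(1) by (metis linorder_not_le order_less_imp_le order_refl)
    obtain b where b: "b \<in> I" "max c s \<le> b" "max c s < b \<or> (\<forall>x\<in>I. x \<le> max c s)"
      using m(2) by (metis linorder_not_le order_less_imp_le order_refl)
    define l where "l = (if a < min c s then a else a - 1)"
    define u where "u = (if max c s < b then b else b + 1)"
    have su: "s \<in> {l<..<u}"
      using a b by (auto simp: l_def u_def)
    have "a \<le> x \<and> x \<le> b" if "x \<in> I" "l < x" "x < u" for x
      using a b that by (fastforce simp: l_def u_def split: if_splits)
    then have inter: "I \<inter> {l<..<u} = {a..b} \<inter> {l<..<u}"
      using sub[OF a(1) b(1)] by auto
    have "at s within I = at s within {a..b}"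
      using su inter by (intro at_within_nhd[of s "{l<..<u}"]) auto
    then show ?thesis
      using on_ab[OF a(1) b(1)] a b by auto
  qed
  then show ?thesis
    unfolding rm_angle_def has_real_derivative_iff_has_vector_derivative by blast
qed

end

end

theory Submission
  imports Defs
begin

text \<open>
  For the quadric \<open>x\<^sup>2 + y\<^sup>2 + 2 c\<^sub>1 x + 2 c\<^sub>2 y + 2 c\<^sub>3 z + c\<^sub>4 = 0\<close> half the gradient at a point is
  \<open>g = (x + c\<^sub>1, y + c\<^sub>2, c\<^sub>3)\<close>.  Suppose that \<open>\<alpha>\<close> stays on it.  One derivative gives \<open>g \<bullet> t = 0\<close>, and
  a second one, with \<open>t' = \<kappa>\<^sub>1 n\<^sub>1 + \<kappa>\<^sub>2 n\<^sub>2\<close>, gives \<open>1 + \<kappa>\<^sub>1 (g \<bullet> n\<^sub>1) + \<kappa>\<^sub>2 c\<^sub>3 = 0\<close>.  Since \<open>n\<^sub>1' = - \<kappa>\<^sub>1 t\<close>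
  is tangential and \<open>g'\<close>, the horizontal part of \<open>t\<close>, is orthogonal to \<open>n\<^sub>1\<close>, the number \<open>m = g \<bullet> n\<^sub>1\<close> is
  constant.  So the normal development satisfies \<open>1 + m \<kappa>\<^sub>1 + c\<^sub>3 \<kappa>\<^sub>2 = 0\<close>, the equation of a line that
  misses the origin (\<open>curve_in_quadric_imp_line\<close>).

  Conversely, the two equations \<open>g \<bullet> t = 0\<close> and \<open>g \<bullet> n\<^sub>1 = m\<close> determine the horizontal part of \<open>g\<close>,
  because the horizontal parts of \<open>t\<close> and \<open>n\<^sub>1\<close> are orthonormal.  When the normal development satisfies
  the line equation, the horizontal vector found in this way has the same derivative as \<open>\<alpha>\<close>, so that
  the difference is a constant vector \<open>(c\<^sub>1, c\<^sub>2)\<close>, and then \<open>g \<bullet> t = 0\<close> makes the quadratic polynomial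
  constant along \<open>\<alpha>\<close> (\<open>line_imp_curve_in_quadric\<close>).

  In the case \<open>c\<^sub>3 = 0\<close> the vector \<open>g\<close> equals \<open>m\<close> times the horizontal part of \<open>n\<^sub>1\<close>, so the quadric is
  the cylinder of squared radius \<open>m\<^sup>2\<close>, while the line equation becomes \<open>\<kappa> = - 1 / m\<close>.  This gives the
  statement about cylinders, and also shows that the quadric of the converse is never degenerate.
\<close>

section \<open>Lines that miss the origin\<close>

lemma plane_line_eq_hyperplane:
  "plane_line L \<longleftrightarrow> (\<exists>a b c. (a, b) \<noteq> (0, 0) \<and> L = {(x, y). a * x + b * y = c})"
proof
  assume L: "plane_line L"
  then have "aff_dim L = DIM(real \<times> real) - 1" "affine hull L = L"
    by (simp_all add: plane_line_def affine_hull_eq)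
  then obtain v c where v: "v \<noteq> 0" "L = {x. v \<bullet> x = c}"
    using aff_dim_eq_hyperplane[of L] by metis
  then have "(fst v, snd v) \<noteq> (0, 0)" "L = {(x, y). fst v * x + snd v * y = c}"
    by (auto simp: prod_eq_iff inner_prod_def)
  then show "\<exists>a b c. (a, b) \<noteq> (0, 0) \<and> L = {(x, y). a * x + b * y = c}"
    by blast
next
  assume "\<exists>a b c. (a, b) \<noteq> (0, 0) \<and> L = {(x, y). a * x + b * y = c}"
  then obtain a b c where ab: "(a, b) \<noteq> (0, 0)" and L: "L = {(x, y). a * x + b * y = c}"
    by blast
  have L': "L = {x. (a, b) \<bullet> x = c}"
    by (auto simp: L inner_prod_def)
  have "aff_dim {x. (a, b) \<bullet> x = c} = DIM(real \<times> real) - 1"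
    using ab by (intro aff_dim_hyperplane) (simp add: zero_prod_def)
  then show "plane_line L"
    unfolding plane_line_def L' by (simp add: affine_hyperplane)
qed

text \<open>Dividing by the constant term normalizes the equation of a line that misses the origin.  For a
  nonempty set the normalized equation cannot have both coefficients zero.\<close>

lemma subset_plane_line_off_origin_iff:
  assumes "S \<noteq> {}"
  shows "(\<exists>L. plane_line L \<and> 0 \<notin> L \<and> S \<subseteq> L)
    \<longleftrightarrow> (\<exists>m c. \<forall>(x, y)\<in>S. 1 + m * x + c * y = 0)"
proof
  assume "\<exists>L. plane_line L \<and> 0 \<notin> L \<and> S \<subseteq> L"
  then obtain L where "plane_line L" and L0: "0 \<notin> L" "S \<subseteq> L"
    by blast
  then obtain a b c where "L = {(x, y). a * x + b * y = c}"
    unfolding plane_line_eq_hyperplane by blast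
  with L0 have L: "0 \<notin> {(x, y). a * x + b * y = c}" "S \<subseteq> {(x, y). a * x + b * y = c}"
    by simp_all
  from L(1) have "c \<noteq> 0"
    by (simp add: zero_prod_def)
  have "1 + (- a / c) * x + (- b / c) * y = 0" if "(x, y) \<in> S" for x y
  proof -
    have "a * x + b * y = c"
      using L(2) that by auto
    moreover have "1 + (- a / c) * x + (- b / c) * y = 1 - (a * x + b * y) / c"
      by (simp add: add_divide_distrib)
    ultimately show ?thesis
      using \<open>c \<noteq> 0\<close> by simp
  qed
  then show "\<exists>m c. \<forall>(x, y)\<in>S. 1 + m * x + c * y = 0"
    by blast
next
  assume "\<exists>m c. \<forall>(x, y)\<in>S. 1 + m * x + c * y = 0"
  then obtain m c where S: "\<And>x y. (x, y) \<in> S \<Longrightarrow> 1 + m * x + c * y = 0"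
    by blast
  define L where "L = {(x, y). m * x + c * y = - 1}"
  have "(m, c) \<noteq> (0, 0)"
    using assms S by fastforce
  then have "plane_line L"
    unfolding plane_line_eq_hyperplane L_def by blast
  moreover have "0 \<notin> L"
    by (simp add: L_def zero_prod_def)
  moreover have "S \<subseteq> L"
    using S by (force simp: L_def)
  ultimately show "\<exists>L. plane_line L \<and> 0 \<notin> L \<and> S \<subseteq> L"
    by blast
qed

section \<open>Curves in quadrics\<close>

lemma plane_orthonormal_pythagoras:
  fixes t1 t2 n1 n2 q1 q2 :: real
  assumes "t1\<^sup>2 + t2\<^sup>2 = 1" "n1\<^sup>2 + n2\<^sup>2 = 1" "t1 * n1 + t2 * n2 = 0"
  shows "q1\<^sup>2 + q2\<^sup>2 = (q1 * t1 + q2 * t2)\<^sup>2 + (q1 * n1 + q2 * n2)\<^sup>2"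
  using assms by algebra

lemma (in isotropic_curve) constant_on_I:
  assumes "\<And>s. s \<in> I \<Longrightarrow> (f has_real_derivative 0) (at s within I)"
  obtains c where "\<And>s. s \<in> I \<Longrightarrow> f s = c"
  using has_field_derivative_zero_constant[of I f] I(1) assms is_interval_convex by blast

locale rotation_minimizing_curve = isotropic_curve +
  fixes \<theta> :: "real \<Rightarrow> real"
  assumes angle: "rm_angle I \<alpha> \<theta>"
begin

abbreviation "k1 \<equiv> rm_kappa1 I \<alpha>"
abbreviation "k2 \<equiv> rm_kappa2 I \<alpha> \<theta>"
abbreviation "N \<equiv> rm_n1 I \<alpha> \<theta>"

lemma T_nth_deriv:
  assumes "s \<in> I"
  shows "((\<lambda>s. T s $ 1) has_real_derivative k1 s * N s $ 1) (at s within I)"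
    and "((\<lambda>s. T s $ 2) has_real_derivative k1 s * N s $ 2) (at s within I)"
    and "((\<lambda>s. T s $ 3) has_real_derivative k1 s * N s $ 3 + k2 s) (at s within I)"
  using vec_nth_has_real_derivative[OF rm_t_deriv[OF assms, of \<theta>], of 1]
    vec_nth_has_real_derivative[OF rm_t_deriv[OF assms, of \<theta>], of 2]
    vec_nth_has_real_derivative[OF rm_t_deriv[OF assms, of \<theta>], of 3]
  by (simp_all add: frenet_t_def rm_n2_def)

lemma N_nth_deriv:
  "s \<in> I \<Longrightarrow> ((\<lambda>s. N s $ i) has_real_derivative - (k1 s * T s $ i)) (at s within I)"
  using vec_nth_has_real_derivative[OF rm_n1_deriv[OF _ angle], of s i]
  by (simp add: frenet_t_def)

lemma alpha_nth_deriv: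
  "s \<in> I \<Longrightarrow> ((\<lambda>s. \<alpha> s $ i) has_real_derivative T s $ i) (at s within I)"
  by (rule vec_nth_has_real_derivative[OF derivs(1)])

text \<open>Passing from \<open>n\<close> to \<open>n\<^sub>1 = n - \<theta> b\<close> changes only the third component, so the horizontal part is
  still \<open>t' / \<kappa>\<close>, and \<open>t'\<close> is orthogonal to \<open>t\<close>.\<close>

lemma horizontal_frame:
  assumes "s \<in> I"
  shows "(N s $ 1)\<^sup>2 + (N s $ 2)\<^sup>2 = 1" and "T s $ 1 * N s $ 1 + T s $ 2 * N s $ 2 = 0"
proof -
  define k where "k = iso_curvature I \<alpha> s"
  have k: "k > 0" "(A s $ 1)\<^sup>2 + (A s $ 2)\<^sup>2 = k\<^sup>2"
    using curvature_pos[OF assms] by (simp_all add: k_def curvature_eq)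
  have N: "N s $ 1 = A s $ 1 / k" "N s $ 2 = A s $ 2 / k"
    by (simp_all add: rm_n1_def frenet_n_def frenet_t_def k_def divide_inverse mult.commute)
  show "(N s $ 1)\<^sup>2 + (N s $ 2)\<^sup>2 = 1"
    using k by (simp add: N power_divide flip: add_divide_distrib)
  show "T s $ 1 * N s $ 1 + T s $ 2 * N s $ 2 = 0"
    using orth[OF assms] by (simp add: N flip: add_divide_distrib)
qed

text \<open>The coefficient \<open>m\<close> of the line is the component of half the gradient along \<open>n\<^sub>1\<close>, which is constant.
  For \<open>c\<^sub>3 = 0\<close> the gradient is horizontal and has no component along \<open>t\<close>, so by Pythagoras \<open>\<bar>m\<bar>\<close> is its
  length, that is, the radius of the cylinder.\<close>

lemma curve_in_quadric_imp_line:
  assumes Q: "\<alpha> ` I \<subseteq> iso_quadric c1 c2 c3 c4"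
  obtains m where "\<And>s. s \<in> I \<Longrightarrow> 1 + m * k1 s + c3 * k2 s = 0"
    and "c3 = 0 \<Longrightarrow> m\<^sup>2 = c1\<^sup>2 + c2\<^sup>2 - c4"
proof -
  \<comment> \<open>Half the gradient of the quadric at \<open>\<alpha> s\<close>, as a linear form.\<close>
  define g where "g s v = (\<alpha> s $ 1 + c1) * v $ 1 + (\<alpha> s $ 2 + c2) * v $ 2 + c3 * v $ 3"
    for s and v :: "real^3"
  have on: "(\<alpha> s $ 1)\<^sup>2 + (\<alpha> s $ 2)\<^sup>2 + 2 * c1 * \<alpha> s $ 1 + 2 * c2 * \<alpha> s $ 2 + 2 * c3 * \<alpha> s $ 3 + c4 = 0"
    if "s \<in> I" for s
    using Q that by (auto simp: iso_quadric_def)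
  have gT: "g s (T s) = 0" if s: "s \<in> I" for s
  proof -
    have "((\<lambda>s. (\<alpha> s $ 1)\<^sup>2 + (\<alpha> s $ 2)\<^sup>2 + 2 * c1 * \<alpha> s $ 1 + 2 * c2 * \<alpha> s $ 2 + 2 * c3 * \<alpha> s $ 3 + c4)
        has_real_derivative 2 * g s (T s)) (at s within I)"
      by (rule derivative_eq_intros alpha_nth_deriv s refl | simp add: g_def algebra_simps)+
    from const_on_deriv[OF I s on this] show ?thesis by simp
  qed
  have line: "1 + g s (N s) * k1 s + c3 * k2 s = 0" if s: "s \<in> I" for s
  proof -
    have "((\<lambda>s. g s (T s)) has_real_derivative
        (T s $ 1)\<^sup>2 + (T s $ 2)\<^sup>2 + g s (N s) * k1 s + c3 * k2 s) (at s within I)"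
      unfolding g_def
      by (rule derivative_eq_intros alpha_nth_deriv T_nth_deriv s refl
          | simp add: power2_eq_square algebra_simps)+
    from const_on_deriv[OF I s gT this] show ?thesis
      using unit[OF s] by simp
  qed
  have "((\<lambda>s. g s (N s)) has_real_derivative 0) (at s within I)" if s: "s \<in> I" for s
  proof -
    have "((\<lambda>s. g s (N s)) has_real_derivative
        (T s $ 1 * N s $ 1 + T s $ 2 * N s $ 2) - k1 s * g s (T s)) (at s within I)"
      unfolding g_def
      by (rule derivative_eq_intros alpha_nth_deriv N_nth_deriv s refl
          | simp add: power2_eq_square algebra_simps)+
    then show ?thesis
      by (simp add: horizontal_frame[OF s] gT[OF s])
  qed
  then obtain m where m: "\<And>s. s \<in> I \<Longrightarrow> g s (N s) = m"
    using constant_on_I by blast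
  show thesis
  proof
    show "1 + m * k1 s + c3 * k2 s = 0" if "s \<in> I" for s
      using line m that by metis
    show "m\<^sup>2 = c1\<^sup>2 + c2\<^sup>2 - c4" if "c3 = 0"
    proof -
      obtain s where s: "s \<in> I"
        using I(2) interior_subset by blast
      have "(\<alpha> s $ 1 + c1)\<^sup>2 + (\<alpha> s $ 2 + c2)\<^sup>2 = (g s (T s))\<^sup>2 + (g s (N s))\<^sup>2"
        using plane_orthonormal_pythagoras[OF unit[OF s] horizontal_frame[OF s]] that
        by (simp add: g_def)
      then have "(\<alpha> s $ 1 + c1)\<^sup>2 + (\<alpha> s $ 2 + c2)\<^sup>2 = m\<^sup>2"
        by (simp add: gT[OF s] m[OF s])
      then show ?thesis
        using on[OF s] that by (simp add: power2_eq_square algebra_simps)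
    qed
  qed
qed

text \<open>The gradient of the quadric is recovered from its components \<open>0\<close> along \<open>t\<close> and \<open>m\<close> along \<open>n\<^sub>1\<close>.  The
  line equation is exactly the condition under which its horizontal part differs from \<open>\<alpha>\<close> by a
  constant, and this constant is the centre \<open>(- c\<^sub>1, - c\<^sub>2)\<close> up to sign.\<close>

lemma line_imp_curve_in_quadric:
  assumes line: "\<And>s. s \<in> I \<Longrightarrow> 1 + m * k1 s + c3 * k2 s = 0"
  obtains c1 c2 c4 where "\<alpha> ` I \<subseteq> iso_quadric c1 c2 c3 c4"
    and "c3 = 0 \<Longrightarrow> c1\<^sup>2 + c2\<^sup>2 - c4 = m\<^sup>2"
proof -
  \<comment> \<open>The horizontal vector with \<open>q \<bullet> t + c3 * t $ 3 = 0\<close> and \<open>q \<bullet> n\<^sub>1 + c3 * n\<^sub>1 $ 3 = m\<close>.\<close>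
  define q where "q i s = - (c3 * T s $ 3 * T s $ i) + (m - c3 * N s $ 3) * N s $ i" for i s
  have q_deriv: "(q i has_real_derivative T s $ i) (at s within I)"
    if s: "s \<in> I" and Ti: "((\<lambda>s. T s $ i) has_real_derivative k1 s * N s $ i) (at s within I)"
    for i s
  proof -
    have "(q i has_real_derivative - (m * k1 s + c3 * k2 s) * T s $ i) (at s within I)"
      unfolding q_def[abs_def]
      by (rule derivative_eq_intros Ti T_nth_deriv(3) N_nth_deriv s refl
          | simp add: algebra_simps)+
    moreover have "- (m * k1 s + c3 * k2 s) = 1"
      using line[OF s] by simp
    ultimately show ?thesis by simp
  qed
  have diff_deriv: "((\<lambda>s. q i s - \<alpha> s $ i) has_real_derivative 0) (at s within I)"
    if "s \<in> I" "((\<lambda>s. T s $ i) has_real_derivative k1 s * N s $ i) (at s within I)" for i s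
    using DERIV_diff[OF q_deriv[OF that] alpha_nth_deriv[OF that(1), of i]] by simp
  obtain c1 where c1: "\<And>s. s \<in> I \<Longrightarrow> q 1 s - \<alpha> s $ 1 = c1"
    using constant_on_I[OF diff_deriv[OF _ T_nth_deriv(1)]] by blast
  obtain c2 where c2: "\<And>s. s \<in> I \<Longrightarrow> q 2 s - \<alpha> s $ 2 = c2"
    using constant_on_I[OF diff_deriv[OF _ T_nth_deriv(2)]] by blast
  have q: "\<alpha> s $ 1 + c1 = q 1 s" "\<alpha> s $ 2 + c2 = q 2 s" if "s \<in> I" for s
    using c1[OF that] c2[OF that] by simp_all
  define F where "F s = (\<alpha> s $ 1)\<^sup>2 + (\<alpha> s $ 2)\<^sup>2 + 2 * c1 * \<alpha> s $ 1 + 2 * c2 * \<alpha> s $ 2 + 2 * c3 * \<alpha> s $ 3"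
    for s
  have "(F has_real_derivative 0) (at s within I)" if s: "s \<in> I" for s
  proof -
    have "(F has_real_derivative
        2 * ((\<alpha> s $ 1 + c1) * T s $ 1 + (\<alpha> s $ 2 + c2) * T s $ 2 + c3 * T s $ 3)) (at s within I)"
      unfolding F_def[abs_def]
      by (rule derivative_eq_intros alpha_nth_deriv s refl | simp add: algebra_simps)+
    moreover have "q 1 s * T s $ 1 + q 2 s * T s $ 2
        = - c3 * T s $ 3 * ((T s $ 1)\<^sup>2 + (T s $ 2)\<^sup>2)
          + (m - c3 * N s $ 3) * (T s $ 1 * N s $ 1 + T s $ 2 * N s $ 2)"
      by (simp add: q_def power2_eq_square algebra_simps)
    ultimately show ?thesis
      by (simp add: q[OF s] unit[OF s] horizontal_frame[OF s])
  qed
  then obtain c where c: "\<And>s. s \<in> I \<Longrightarrow> F s = c"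
    using constant_on_I by blast
  show thesis
  proof
    show "\<alpha> ` I \<subseteq> iso_quadric c1 c2 c3 (- c)"
      using c by (auto simp: iso_quadric_def F_def)
    show "c1\<^sup>2 + c2\<^sup>2 - - c = m\<^sup>2" if "c3 = 0"
    proof -
      obtain s where s: "s \<in> I"
        using I(2) interior_subset by blast
      have "c1\<^sup>2 + c2\<^sup>2 - - c = (\<alpha> s $ 1 + c1)\<^sup>2 + (\<alpha> s $ 2 + c2)\<^sup>2"
        using c[OF s] that by (simp add: F_def power2_eq_square algebra_simps)
      also have "\<dots> = m\<^sup>2 * ((N s $ 1)\<^sup>2 + (N s $ 2)\<^sup>2)"
        by (simp add: q[OF s] q_def that power_mult_distrib distrib_left)
      finally show ?thesis
        by (simp add: horizontal_frame[OF s])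
    qed
  qed
qed

section \<open>Spherical curves\<close>

lemma spherical_iff_line:
  "(\<exists>S. isotropic_sphere S \<and> \<alpha> ` I \<subseteq> S) \<longleftrightarrow> (\<exists>m c. \<forall>s\<in>I. 1 + m * k1 s + c * k2 s = 0)"
proof
  assume "\<exists>S. isotropic_sphere S \<and> \<alpha> ` I \<subseteq> S"
  then show "\<exists>m c. \<forall>s\<in>I. 1 + m * k1 s + c * k2 s = 0"
    unfolding isotropic_sphere_def using curve_in_quadric_imp_line by metis
next
  assume "\<exists>m c. \<forall>s\<in>I. 1 + m * k1 s + c * k2 s = 0"
  then obtain m c3 where line: "\<And>s. s \<in> I \<Longrightarrow> 1 + m * k1 s + c3 * k2 s = 0"
    by blast
  then obtain c1 c2 c4 where Q: "\<alpha> ` I \<subseteq> iso_quadric c1 c2 c3 c4"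
      "c3 = 0 \<Longrightarrow> c1\<^sup>2 + c2\<^sup>2 - c4 = m\<^sup>2"
    using line_imp_curve_in_quadric by metis
  \<comment> \<open>If \<open>c3\<close> and \<open>m\<close> both vanish, then the line equation reads \<open>1 = 0\<close>.\<close>
  have "c3 \<noteq> 0 \<or> m \<noteq> 0"
    using line I(2) interior_subset by fastforce
  then have "c3 \<noteq> 0 \<or> c1\<^sup>2 + c2\<^sup>2 - c4 > 0"
    using Q(2) by fastforce
  then show "\<exists>S. isotropic_sphere S \<and> \<alpha> ` I \<subseteq> S"
    unfolding isotropic_sphere_def using Q(1) by blast
qed

lemma cylindrical_iff_curvature:
  assumes r: "r > 0"
  shows "(\<exists>P. \<alpha> ` I \<subseteq> cylindrical_sphere P r) \<longleftrightarrow> (\<forall>s\<in>I. iso_curvature I \<alpha> s = inverse r)"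
proof
  assume "\<exists>P. \<alpha> ` I \<subseteq> cylindrical_sphere P r"
  then obtain P :: "real^3"
    where "\<alpha> ` I \<subseteq> iso_quadric (- P $ 1) (- P $ 2) 0 ((P $ 1)\<^sup>2 + (P $ 2)\<^sup>2 - r\<^sup>2)"
    by (auto simp: cylindrical_sphere_eq_iso_quadric)
  then obtain m where m: "\<And>s. s \<in> I \<Longrightarrow> 1 + m * k1 s + 0 * k2 s = 0"
      "m\<^sup>2 = (- P $ 1)\<^sup>2 + (- P $ 2)\<^sup>2 - ((P $ 1)\<^sup>2 + (P $ 2)\<^sup>2 - r\<^sup>2)"
    by (rule curve_in_quadric_imp_line) auto
  then have mr: "m = r \<or> m = - r"
    by (simp add: power2_eq_iff)
  show "\<forall>s\<in>I. iso_curvature I \<alpha> s = inverse r"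
  proof
    fix s assume s: "s \<in> I"
    have k: "1 + m * iso_curvature I \<alpha> s = 0" "iso_curvature I \<alpha> s > 0"
      using m(1)[OF s] curvature_pos[OF s] by (simp_all add: rm_kappa1_def)
    \<comment> \<open>The sign of \<open>m\<close> is forced because curvature and radius are positive.\<close>
    have "m \<noteq> r"
      using mult_pos_pos[OF r k(2)] k(1) by auto
    then show "iso_curvature I \<alpha> s = inverse r"
      using mr k r by (simp add: field_simps)
  qed
next
  assume k: "\<forall>s\<in>I. iso_curvature I \<alpha> s = inverse r"
  have "1 + (- r) * k1 s + 0 * k2 s = 0" if "s \<in> I" for s
    using k r that by (simp add: rm_kappa1_def)
  then obtain c1 c2 c4 where Q: "\<alpha> ` I \<subseteq> iso_quadric c1 c2 0 c4" "c1\<^sup>2 + c2\<^sup>2 - c4 = (- r)\<^sup>2"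
    using line_imp_curve_in_quadric[of "- r" 0] by metis
  then have "iso_quadric c1 c2 0 c4 = cylindrical_sphere (vector [- c1, - c2, 0]) r"
    using r by (simp add: iso_quadric_eq_cylindrical_sphere)
  then show "\<exists>P. \<alpha> ` I \<subseteq> cylindrical_sphere P r"
    using Q(1) by metis
qed

end

theorem theorem5p4p2:
  fixes I :: "real set" and \<alpha> :: "real \<Rightarrow> real^3"
  assumes "is_interval I" and "interior I \<noteq> {}"
    and "C_k_on 3 I \<alpha>" and "regular_curve I \<alpha>" and "admissible I \<alpha>" and "iso_arclength I \<alpha>"
  shows "(\<forall>\<theta>. rm_angle I \<alpha> \<theta> \<longrightarrow>
            ((\<exists>S. isotropic_sphere S \<and> \<alpha> ` I \<subseteq> S) \<longleftrightarrow>
             (\<exists>L. plane_line L \<and> 0 \<notin> L \<and> normal_development I \<alpha> \<theta> ` I \<subseteq> L)))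
       \<and> (\<forall>r>0. (\<exists>P. \<alpha> ` I \<subseteq> cylindrical_sphere P r) \<longleftrightarrow>
                 (\<forall>s\<in>I. iso_curvature I \<alpha> s = inverse r))"
proof (intro conjI allI impI)
  interpret isotropic_curve I \<alpha>
    using assms by unfold_locales
  have rm: "rotation_minimizing_curve I \<alpha> \<theta>" if "rm_angle I \<alpha> \<theta>" for \<theta>
    using that by unfold_locales
  show "(\<exists>S. isotropic_sphere S \<and> \<alpha> ` I \<subseteq> S) \<longleftrightarrow>
      (\<exists>L. plane_line L \<and> 0 \<notin> L \<and> normal_development I \<alpha> \<theta> ` I \<subseteq> L)"
    if "rm_angle I \<alpha> \<theta>" for \<theta>
  proof -
    have "normal_development I \<alpha> \<theta> ` I \<noteq> {}"
      using I(2) interior_subset by fastforce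
    then show ?thesis
      unfolding rotation_minimizing_curve.spherical_iff_line[OF rm[OF that]]
      by (simp add: subset_plane_line_off_origin_iff normal_development_def)
  qed
  \<comment> \<open>The curvature does not depend on \<open>\<theta>\<close>, so the claim follows from any rotation minimizing frame.\<close>
  show "(\<exists>P. \<alpha> ` I \<subseteq> cylindrical_sphere P r) \<longleftrightarrow> (\<forall>s\<in>I. iso_curvature I \<alpha> s = inverse r)"
    if "r > 0" for r
    using rm_angle_exists rotation_minimizing_curve.cylindrical_iff_curvature[OF rm that] by blast
qed

end
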